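(* For every integer $n\ge1$, the bivariate Laurent polynomial $$\hat a_n(z_1,z_2)=\sum_{i=0}^{n-1}u_{n-i}^{n-i-1}(z_1)\,u_{i+1}^{i}(z_2)-\sum_{i=0}^{n-2}u_{n-i-1}^{n-i-2}(z_1)\,u_{i+1}^{i}(z_2)$$ (the second sum being empty for $n=1$) is interpolatory, generates polynomials up to degree $2n-1$, reproduces polynomials up to degree $2n-1$, and is minimally supported, i.e. the size of its support is minimal among the supports of all symmetric interpolatory symbols that generate polynomials up to degree $2n-1$.
   Context: A symbol is a bivariate Laurent polynomial $a(z_1,z_2)=\sum_{\alpha\in\mathbb Z^2}a_\alpha z_1^{\alpha_1}z_2^{\alpha_2}$ with finitely many nonzero real coefficients $a_\alpha$, regarded as a function of $(z_1,z_2)\in(\mathbb C\setminus\{0\})^2$. For $k=(k_1,k_2)\in\mathbb N_0^2$, $D^k=\partial_{z_1}^{k_1}\partial_{z_2}^{k_2}$ and $|k|=k_1+k_2$. Let $E'=\{(-1,1),(1,-1),(-1,-1)\}$. Symmetric: $a(z_1,z_2)=a(1/z_1,z_2)=a(z_1,1/z_2)=a(z_2,z_1)$. Generates polynomials up to degree $m$: $(D^k a)(z)=0$ for all $z\in E'$ and all $k\in\mathbb N_0^2$ with $0\le|k|\le m$. Reproduces polynomials up to degree $m'$ (for a symbol that generates polynomials up to some degree $m\ge m'$): $a(1,1)=4$ and $(D^k a)(1,1)=0$ for all $k\in\mathbb N_0^2$ with $0<|k|\le m'$. Interpolatory: $a(z_1,z_2)+a(z_1,-z_2)+a(-z_1,z_2)+a(-z_1,-z_2)=4$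 (equivalently $a_{(0,0)}=1$ and $a_{2\alpha}=0$ for $\alpha\in\mathbb Z^2\setminus\{(0,0)\}$). Support: the support of a symbol is the convex hull in $\mathbb R^2$ of $\{\alpha\in\mathbb Z^2: a_\alpha\ne0\}$, and the size of the support is the area of this convex hull. Univariate pseudo-splines: with $\sigma(z)=\frac{(1+z)^2}{4z}$ and $\delta(z)=-\frac{(1-z)^2}{4z}$, $$u_n^l(z)=2\,\sigma(z)^n\sum_{i=0}^{l}\binom{n+i-1}{i}\delta(z)^i,\qquad 0\le l<n.$$ *)

theory Defs
  imports "HOL-Analysis.Analysis" "HOL-Library.Poly_Mapping"
begin

text \<open>
  Real Laurent polynomials in one and two variables are finitely supported coefficient families,
  indexed by the (possibly negative) exponents.
\<close>

type_synonym laurent = "int \<Rightarrow>\<^sub>0 real"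
type_synonym symbol = "(int \<times> int) \<Rightarrow>\<^sub>0 real"

abbreviation coef :: "('i \<Rightarrow>\<^sub>0 real) \<Rightarrow> 'i \<Rightarrow> real"
  where "coef \<equiv> Poly_Mapping.lookup"

definition leval :: "laurent \<Rightarrow> complex \<Rightarrow> complex"
  where "leval p z = (\<Sum>i\<in>Poly_Mapping.keys p. of_real (coef p i) * z powi i)"

text \<open>
  As \<^term>\<open>0 powi i\<close> is a junk value for negative \<open>i\<close>, values of these evaluation
  functions are only meaningful at non-zero arguments.
\<close>

definition seval :: "symbol \<Rightarrow> complex \<Rightarrow> complex \<Rightarrow> complex"
  where "seval a z1 z2 =
    (\<Sum>\<alpha>\<in>Poly_Mapping.keys a. of_real (coef a \<alpha>) * z1 powi fst \<alpha> * z2 powi snd \<alpha>)"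

definition Dk :: "nat \<times> nat \<Rightarrow> (complex \<Rightarrow> complex \<Rightarrow> complex) \<Rightarrow> complex \<Rightarrow> complex \<Rightarrow> complex"
  where "Dk k f z1 z2 =
    (deriv ^^ fst k) (\<lambda>w1. (deriv ^^ snd k) (\<lambda>w2. f w1 w2) z2) z1"

definition E' :: "(complex \<times> complex) set"
  where "E' = {(-1, 1), (1, -1), (-1, -1)}"

definition symmetric_symbol :: "symbol \<Rightarrow> bool"
  where "symmetric_symbol a \<longleftrightarrow> (\<forall>z1 z2. z1 \<noteq> 0 \<longrightarrow> z2 \<noteq> 0 \<longrightarrow>
    seval a z1 z2 = seval a (1 / z1) z2 \<and>
    seval a z1 z2 = seval a z1 (1 / z2) \<and>
    seval a z1 z2 = seval a z2 z1)"

definition generates_polynomials :: "symbol \<Rightarrow> nat \<Rightarrow> bool"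
  where "generates_polynomials a m \<longleftrightarrow>
    (\<forall>(z1, z2)\<in>E'. \<forall>k. fst k + snd k \<le> m \<longrightarrow> Dk k (seval a) z1 z2 = 0)"

definition reproduces_polynomials :: "symbol \<Rightarrow> nat \<Rightarrow> bool"
  where "reproduces_polynomials a m' \<longleftrightarrow>
    (\<exists>m\<ge>m'. generates_polynomials a m) \<and>
    seval a 1 1 = 4 \<and>
    (\<forall>k. 0 < fst k + snd k \<and> fst k + snd k \<le> m' \<longrightarrow> Dk k (seval a) 1 1 = 0)"

definition interpolatory :: "symbol \<Rightarrow> bool"
  where "interpolatory a \<longleftrightarrow> (\<forall>z1 z2. z1 \<noteq> 0 \<longrightarrow> z2 \<noteq> 0 \<longrightarrow>
    seval a z1 z2 + seval a z1 (- z2) + seval a (- z1) z2 + seval a (- z1) (- z2) = 4)"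

definition symbol_support :: "symbol \<Rightarrow> (real \<times> real) set"
  where "symbol_support a =
    convex hull {(real_of_int \<alpha>1, real_of_int \<alpha>2) | \<alpha>1 \<alpha>2. coef a (\<alpha>1, \<alpha>2) \<noteq> 0}"

definition support_size :: "symbol \<Rightarrow> real"
  where "support_size a = measure lborel (symbol_support a)"

definition Z :: laurent
  where "Z = Poly_Mapping.single 1 1"

text \<open>\<open>(1 + z)\<^sup>2 / (4 z)\<close> and \<open>- (1 - z)\<^sup>2 / (4 z)\<close>; the factor \<open>1 / (4 z)\<close> is the monomial
  with exponent \<open>- 1\<close> and coefficient \<open>1 / 4\<close>.\<close>

definition sigma :: laurent
  where "sigma = (1 + Z)\<^sup>2 * Poly_Mapping.single (- 1) (1 / 4)"

definition delta :: laurent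
  where "delta = - ((1 - Z)\<^sup>2 * Poly_Mapping.single (- 1) (1 / 4))"

definition pseudo_spline :: "nat \<Rightarrow> nat \<Rightarrow> laurent"
  where "pseudo_spline n l =
    2 * sigma ^ n * (\<Sum>i=0..l. of_nat ((n + i - 1) choose i) * delta ^ i)"

text \<open>The bivariate Laurent polynomial \<open>p(z\<^sub>1) q(z\<^sub>2)\<close>.\<close>

definition tensor :: "laurent \<Rightarrow> laurent \<Rightarrow> symbol"
  where "tensor p q =
    (\<Sum>i\<in>Poly_Mapping.keys p. \<Sum>j\<in>Poly_Mapping.keys q.
      Poly_Mapping.single (i, j) (coef p i * coef q j))"

definition a_hat :: "nat \<Rightarrow> symbol"
  where "a_hat n =
    (\<Sum>i<n. tensor (pseudo_spline (n - i) (n - i - 1)) (pseudo_spline (i + 1) i)) -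
    (\<Sum>i<n - 1. tensor (pseudo_spline (n - i - 1) (n - i - 2)) (pseudo_spline (i + 1) i))"


lemma leval_superset:
  assumes "finite S" "Poly_Mapping.keys p \<subseteq> S"
  shows "leval p z = (\<Sum>i\<in>S. of_real (coef p i) * z powi i)"
  unfolding leval_def using assms
  by (intro sum.mono_neutral_left) (auto simp: in_keys_iff)

lemma seval_superset:
  assumes "finite S" "Poly_Mapping.keys a \<subseteq> S"
  shows "seval a z1 z2 = (\<Sum>\<alpha>\<in>S. of_real (coef a \<alpha>) * z1 powi fst \<alpha> * z2 powi snd \<alpha>)"
  unfolding seval_def using assms
  by (intro sum.mono_neutral_left) (auto simp: in_keys_iff)

lemma leval_0 [simp]: "leval 0 z = 0"
  by (simp add: leval_def)

lemma seval_0 [simp]: "seval 0 z1 z2 = 0"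
  by (simp add: seval_def)

lemma leval_single [simp]: "leval (Poly_Mapping.single i c) z = of_real c * z powi i"
  by (simp add: leval_def)

lemma seval_single [simp]:
  "seval (Poly_Mapping.single \<alpha> c) z1 z2 = of_real c * z1 powi fst \<alpha> * z2 powi snd \<alpha>"
  by (simp add: seval_def)

lemma leval_1 [simp]: "leval 1 z = 1"
  by (simp add: leval_def)

lemma leval_add [simp]: "leval (p + q) z = leval p z + leval q z"
proof -
  let ?S = "Poly_Mapping.keys p \<union> Poly_Mapping.keys q"
  have "Poly_Mapping.keys (p + q) \<subseteq> ?S" by (rule keys_add)
  then show ?thesis
    by (simp add: leval_superset[of ?S] lookup_add algebra_simps sum.distrib)
qed

lemma seval_add [simp]: "seval (a + b) z1 z2 = seval a z1 z2 + seval b z1 z2"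
proof -
  let ?S = "Poly_Mapping.keys a \<union> Poly_Mapping.keys b"
  have "Poly_Mapping.keys (a + b) \<subseteq> ?S" by (rule keys_add)
  then show ?thesis
    by (simp add: seval_superset[of ?S] lookup_add algebra_simps sum.distrib)
qed

lemma leval_diff [simp]: "leval (p - q) z = leval p z - leval q z"
  using leval_add[of "p - q" q z] by simp

lemma leval_uminus [simp]: "leval (- p) z = - leval p z"
  using leval_diff[of 0 p z] by simp

lemma seval_diff [simp]: "seval (a - b) z1 z2 = seval a z1 z2 - seval b z1 z2"
  using seval_add[of "a - b" b z1 z2] by simp

lemma leval_sum [simp]: "leval (sum f A) z = (\<Sum>x\<in>A. leval (f x) z)"
  by (induction A rule: infinite_finite_induct) auto

lemma seval_sum [simp]: "seval (sum f A) z1 z2 = (\<Sum>x\<in>A. seval (f x) z1 z2)"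
  by (induction A rule: infinite_finite_induct) auto

lemma laurent_expand:
  fixes p :: laurent
  shows "p = (\<Sum>i\<in>Poly_Mapping.keys p. Poly_Mapping.single i (coef p i))"
  by (rule poly_mapping_eqI) (auto simp: lookup_sum lookup_single when_def in_keys_iff)

lemma leval_mult [simp]:
  assumes "z \<noteq> 0"
  shows "leval (p * q) z = leval p z * leval q z"
proof -
  have "p * q = (\<Sum>i\<in>Poly_Mapping.keys p. \<Sum>j\<in>Poly_Mapping.keys q.
      Poly_Mapping.single (i + j) (coef p i * coef q j))"
    by (subst laurent_expand[of p], subst laurent_expand[of q])
       (simp add: sum_product mult_single)
  then have "leval (p * q) z = (\<Sum>i\<in>Poly_Mapping.keys p. \<Sum>j\<in>Poly_Mapping.keys q.
      of_real (coef p i * coef q j) * z powi (i + j))"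
    by simp
  also have "\<dots> = leval p z * leval q z"
    using assms unfolding leval_def sum_product
    by (intro sum.cong refl) (simp add: power_int_add)
  finally show ?thesis .
qed

lemma leval_power [simp]: "z \<noteq> 0 \<Longrightarrow> leval (p ^ n) z = leval p z ^ n"
  by (induction n) auto

lemma leval_of_nat [simp]: "leval (of_nat n) z = of_nat n"
  by (induction n) auto

lemma leval_numeral [simp]: "leval (numeral n) z = numeral n"
  using leval_of_nat[of "numeral n" z] by simp

lemma leval_sigma: "z \<noteq> 0 \<Longrightarrow> leval sigma z = (1 + z)\<^sup>2 / (4 * z)"
  by (simp add: sigma_def Z_def power_int_minus field_simps)

lemma leval_delta: "z \<noteq> 0 \<Longrightarrow> leval delta z = - ((1 - z)\<^sup>2 / (4 * z))"
  by (simp add: delta_def Z_def power_int_minus field_simps)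

lemma leval_pseudo_spline:
  assumes "z \<noteq> 0"
  shows "leval (pseudo_spline n l) z =
    2 * ((1 + z)\<^sup>2 / (4 * z)) ^ n *
      (\<Sum>i=0..l. of_nat ((n + i - 1) choose i) * (- ((1 - z)\<^sup>2 / (4 * z))) ^ i)"
  using assms by (simp add: pseudo_spline_def leval_sigma leval_delta)

lemma seval_tensor: "seval (tensor p q) z1 z2 = leval p z1 * leval q z2"
  unfolding tensor_def leval_def sum_product by (simp add: mult_ac)

lemma seval_a_hat:
  "seval (a_hat n) z1 z2 =
    (\<Sum>i<n. leval (pseudo_spline (n - i) (n - i - 1)) z1 * leval (pseudo_spline (i + 1) i) z2) -
    (\<Sum>i<n - 1. leval (pseudo_spline (n - i - 1) (n - i - 2)) z1 *
      leval (pseudo_spline (i + 1) i) z2)"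
  by (simp add: a_hat_def seval_tensor)

end

theory Submission
  imports Defs
begin

text \<open>
  Write \<open>U r\<close> for the pseudo-spline \<open>u_r^{r-1}\<close>. Since
  \<open>U (r + 1) - U r = 2 c (\<sigma> \<delta>)^r (1 - 2 \<delta>)\<close> with \<open>c = binom(2 r - 1, r)\<close>, each \<open>U r\<close> is interpolatory,
  vanishes to order \<open>2 r\<close> at \<open>-1\<close>, and \<open>U (r + 1) - U r\<close> vanishes to order \<open>2 r\<close> at both \<open>1\<close> and \<open>-1\<close>.
  Grouping the two sums as
  \<open>U n(z1) U 1(z2) + (\<Sum>i < n - 1. U (n - 1 - i)(z1) (U (i + 2) - U (i + 1))(z2))\<close>
  shows that the symbol vanishes to order \<open>2 n\<close> on \<open>E'\<close>; for interpolatory symbols this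
  implies reproduction, because the values at the four sign points add up to \<open>4\<close>.

  For minimality even inclusion of supports holds. The support of \<open>a_hat n\<close> lies in the octagon spanned
  by \<open>(\<plusminus>(2 n - 1), \<plusminus>1)\<close> and \<open>(\<plusminus>1, \<plusminus>(2 n - 1))\<close>, while every competitor has a nonzero
  coefficient at some \<open>(i, j)\<close> with \<open>\<bar>i\<bar> \<ge> 2 n - 1\<close> and \<open>j\<close> odd, so by symmetry and convexity its
  support contains this octagon.
\<close>

section \<open>Moments and partial derivatives\<close>

text \<open>The falling factorial x (x - 1) ... (x - k + 1), the factor that k differentiations
  bring down from \<open>z powi x\<close>.\<close>

definition ffact :: "nat \<Rightarrow> int \<Rightarrow> real"
  where "ffact k x = (\<Prod>i<k. of_int x - of_nat i)"

lemma ffact_0 [simp]: "ffact 0 x = 1"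
  by (simp add: ffact_def)

lemma ffact_Suc: "ffact (Suc k) x = (of_int x - of_nat k) * ffact k x"
  by (simp add: ffact_def)

lemma ffact_at_0: "k > 0 \<Longrightarrow> ffact k 0 = 0"
  by (auto simp: ffact_def intro!: bexI[of _ 0])

lemma ffact_shift: "ffact (Suc k) (x + 1) = (of_int x + 1) * ffact k x"
  by (simp add: ffact_def prod.lessThan_Suc_shift del: prod.lessThan_Suc)

definition lmoment :: "laurent \<Rightarrow> (int \<Rightarrow> real) \<Rightarrow> complex \<Rightarrow> complex"
  where "lmoment p g z = (\<Sum>i\<in>Poly_Mapping.keys p. of_real (coef p i * g i) * z powi i)"

definition moment :: "symbol \<Rightarrow> (int \<times> int \<Rightarrow> real) \<Rightarrow> complex \<Rightarrow> complex \<Rightarrow> complex"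
  where "moment a g z1 z2 =
    (\<Sum>\<alpha>\<in>Poly_Mapping.keys a. of_real (coef a \<alpha> * g \<alpha>) * z1 powi fst \<alpha> * z2 powi snd \<alpha>)"

lemma lmoment_superset:
  assumes "finite S" "Poly_Mapping.keys p \<subseteq> S"
  shows "lmoment p g z = (\<Sum>i\<in>S. of_real (coef p i * g i) * z powi i)"
  unfolding lmoment_def using assms
  by (intro sum.mono_neutral_left) (auto simp: in_keys_iff)

lemma moment_superset:
  assumes "finite S" "Poly_Mapping.keys a \<subseteq> S"
  shows "moment a g z1 z2 =
    (\<Sum>\<alpha>\<in>S. of_real (coef a \<alpha> * g \<alpha>) * z1 powi fst \<alpha> * z2 powi snd \<alpha>)"
  unfolding moment_def using assms
  by (intro sum.mono_neutral_left) (auto simp: in_keys_iff)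

lemma lmoment_0 [simp]: "lmoment 0 g z = 0"
  by (simp add: lmoment_def)

lemma moment_0 [simp]: "moment 0 g z1 z2 = 0"
  by (simp add: moment_def)

lemma lmoment_single [simp]:
  "lmoment (Poly_Mapping.single i c) g z = of_real (c * g i) * z powi i"
  by (simp add: lmoment_def)

lemma moment_single [simp]:
  "moment (Poly_Mapping.single \<alpha> c) g z1 z2 =
    of_real (c * g \<alpha>) * z1 powi fst \<alpha> * z2 powi snd \<alpha>"
  by (simp add: moment_def)

lemma lmoment_add: "lmoment (p + q) g z = lmoment p g z + lmoment q g z"
proof -
  let ?S = "Poly_Mapping.keys p \<union> Poly_Mapping.keys q"
  have "Poly_Mapping.keys (p + q) \<subseteq> ?S" by (rule keys_add)
  then show ?thesis
    by (simp add: lmoment_superset[of ?S] lookup_add algebra_simps sum.distrib)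
qed

lemma moment_add: "moment (a + b) g z1 z2 = moment a g z1 z2 + moment b g z1 z2"
proof -
  let ?S = "Poly_Mapping.keys a \<union> Poly_Mapping.keys b"
  have "Poly_Mapping.keys (a + b) \<subseteq> ?S" by (rule keys_add)
  then show ?thesis
    by (simp add: moment_superset[of ?S] lookup_add algebra_simps sum.distrib)
qed

lemma lmoment_diff: "lmoment (p - q) g z = lmoment p g z - lmoment q g z"
  using lmoment_add[of "p - q" q g z] by simp

lemma moment_diff: "moment (a - b) g z1 z2 = moment a g z1 z2 - moment b g z1 z2"
  using moment_add[of "a - b" b g z1 z2] by simp

lemma lmoment_sum: "lmoment (sum f A) g z = (\<Sum>x\<in>A. lmoment (f x) g z)"
  by (induction A rule: infinite_finite_induct) (auto simp: lmoment_add)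

lemma moment_sum: "moment (sum f A) g z1 z2 = (\<Sum>x\<in>A. moment (f x) g z1 z2)"
  by (induction A rule: infinite_finite_induct) (auto simp: moment_add)

lemma moment_tensor:
  "moment (tensor p q) (\<lambda>\<alpha>. g (fst \<alpha>) * h (snd \<alpha>)) z1 z2 = lmoment p g z1 * lmoment q h z2"
  unfolding tensor_def moment_sum lmoment_def sum_product by (simp add: mult_ac)

lemma deriv_iterate_power_int_sum:
  fixes c :: "'i \<Rightarrow> complex" and e :: "'i \<Rightarrow> int"
  assumes "finite S" "z \<noteq> 0"
  shows "(deriv ^^ k) (\<lambda>w. \<Sum>i\<in>S. c i * w powi e i) z =
    (\<Sum>i\<in>S. c i * of_real (ffact k (e i)) * z powi (e i - int k))"
  using assms(2)
proof (induction k arbitrary: z)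
  case (Suc k)
  \<comment> \<open>Differentiating once more needs the k-th derivative on a whole neighbourhood of
    z; the induction hypothesis supplies it on the open set \<open>- {0}\<close>.\<close>
  let ?F = "\<lambda>w. \<Sum>i\<in>S. c i * of_real (ffact k (e i)) * w powi (e i - int k)"
  have "\<forall>\<^sub>F w in nhds z. w \<in> - {0}"
    using Suc.prems by (intro eventually_nhds_in_open) auto
  then have "\<forall>\<^sub>F w in nhds z. (deriv ^^ k) (\<lambda>w. \<Sum>i\<in>S. c i * w powi e i) w = ?F w"
    by eventually_elim (use Suc.IH in auto)
  then have "(deriv ^^ Suc k) (\<lambda>w. \<Sum>i\<in>S. c i * w powi e i) z = deriv ?F z"
    by (simp add: deriv_cong_ev)
  also have "(?F has_field_derivative
      (\<Sum>i\<in>S. c i * of_real (ffact k (e i)) *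
        (of_int (e i - int k) * z powi (e i - int k - 1) * 1))) (at z)"
    using Suc.prems
    by (intro DERIV_sum DERIV_cmult DERIV_power_int DERIV_ident) auto
  then have "deriv ?F z = (\<Sum>i\<in>S. c i * of_real (ffact k (e i)) *
        (of_int (e i - int k) * z powi (e i - int k - 1) * 1))"
    by (rule DERIV_imp_deriv)
  also have "\<dots> = (\<Sum>i\<in>S. c i * of_real (ffact (Suc k) (e i)) * z powi (e i - int (Suc k)))"
    by (intro sum.cong refl) (simp add: ffact_Suc algebra_simps)
  finally show ?case .
qed simp

text \<open>Each derivative lowers an exponent by one; dividing by the monomial undoes this shift
  for all terms at once. At nonzero points, a derivative therefore vanishes exactly when its moment
  does.\<close>

lemma Dk_seval:
  assumes "z1 \<noteq> 0" "z2 \<noteq> 0"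
  shows "Dk k (seval a) z1 z2 =
    moment a (\<lambda>\<alpha>. ffact (fst k) (fst \<alpha>) * ffact (snd k) (snd \<alpha>)) z1 z2 / (z1 ^ fst k * z2 ^ snd k)"
proof -
  let ?K = "Poly_Mapping.keys a"
  have inner: "(deriv ^^ snd k) (\<lambda>w2. seval a w1 w2) z2 =
    (\<Sum>\<alpha>\<in>?K. (of_real (coef a \<alpha>) * of_real (ffact (snd k) (snd \<alpha>)) *
      z2 powi (snd \<alpha> - int (snd k))) * w1 powi fst \<alpha>)" for w1
    unfolding seval_def
    by (subst deriv_iterate_power_int_sum) (use assms in \<open>auto simp: mult_ac\<close>)
  have "Dk k (seval a) z1 z2 =
    (\<Sum>\<alpha>\<in>?K. of_real (coef a \<alpha>) * of_real (ffact (snd k) (snd \<alpha>)) *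
      z2 powi (snd \<alpha> - int (snd k)) * of_real (ffact (fst k) (fst \<alpha>)) *
      z1 powi (fst \<alpha> - int (fst k)))"
    unfolding Dk_def inner by (subst deriv_iterate_power_int_sum) (use assms in auto)
  also have "\<dots> = moment a (\<lambda>\<alpha>. ffact (fst k) (fst \<alpha>) * ffact (snd k) (snd \<alpha>)) z1 z2 /
      (z1 ^ fst k * z2 ^ snd k)"
    unfolding moment_def sum_divide_distrib
    by (intro sum.cong refl) (use assms in \<open>simp add: power_int_diff field_simps\<close>)
  finally show ?thesis .
qed

lemma generates_polynomials_iff_moment:
  "generates_polynomials a m \<longleftrightarrow>
    (\<forall>(z1, z2)\<in>E'. \<forall>k1 k2. k1 + k2 \<le> m \<longrightarrow>
      moment a (\<lambda>\<alpha>. ffact k1 (fst \<alpha>) * ffact k2 (snd \<alpha>)) z1 z2 = 0)"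
  by (auto simp: generates_polynomials_def E'_def Dk_seval)

section \<open>Coefficients of symmetric and interpolatory symbols\<close>

lemma power_int_sum_eq_0:
  fixes c :: "int \<Rightarrow> complex"
  assumes "finite S" and zero: "\<And>z. z \<noteq> 0 \<Longrightarrow> (\<Sum>i\<in>S. c i * z powi i) = 0" and "j \<in> S"
  shows "c j = 0"
proof -
  \<comment> \<open>N bounds every \<open>\<bar>i\<bar>\<close>, so multiplication by z^N turns the
    sum into an ordinary polynomial, which has infinitely many roots.\<close>
  define N where "N = (\<Sum>i\<in>S. \<bar>i\<bar>)"
  have N: "i + N \<ge> 0" if "i \<in> S" for i
    using member_le_sum[of i S abs] that assms(1) by (simp add: N_def)
  have N0: "N \<ge> 0"
    by (simp add: N_def sum_nonneg)
  define P where "P = (\<Sum>i\<in>S. monom (c i) (nat (i + N)))"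
  have "poly P z = 0" if "z \<noteq> 0" for z
  proof -
    have "poly P z = (\<Sum>i\<in>S. c i * z powi (i + N))"
      using N unfolding P_def poly_sum poly_monom
      by (intro sum.cong refl) (simp add: power_int_def)
    also have "\<dots> = z powi N * (\<Sum>i\<in>S. c i * z powi i)"
      using that by (simp add: power_int_add sum_distrib_left mult_ac)
    finally show ?thesis
      using zero[OF that] by simp
  qed
  then have "- {0} \<subseteq> {z. poly P z = 0}"
    by auto
  moreover have "infinite (- {0 :: complex})"
    using infinite_UNIV_char_0[where ?'a = complex] finite_compl[of "{0 :: complex}"]
    by (simp add: Compl_eq_Diff_UNIV)
  ultimately have "P = 0"
    using poly_roots_finite finite_subset by blast
  have "coeff P (nat (j + N)) = (\<Sum>i\<in>S. if i = j then c i else 0)"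
    unfolding P_def coeff_sum
    by (intro sum.cong refl) (use N \<open>j \<in> S\<close> in \<open>auto simp: nat_eq_iff2\<close>)
  then show ?thesis
    using \<open>P = 0\<close> assms by simp
qed

lemma power_int_sum2_eq_0:
  fixes c :: "int \<times> int \<Rightarrow> complex"
  assumes "finite S"
    and zero: "\<And>z1 z2. z1 \<noteq> 0 \<Longrightarrow> z2 \<noteq> 0 \<Longrightarrow>
      (\<Sum>\<alpha>\<in>S. c \<alpha> * z1 powi fst \<alpha> * z2 powi snd \<alpha>) = 0"
    and "\<beta> \<in> S"
  shows "c \<beta> = 0"
proof -
  \<comment> \<open>Extension by zero to the grid \<open>?I \<times> ?J\<close> makes the sum an
    iterated one, so the univariate result applies first in z1 and then in z2.\<close>
  define c' where "c' = (\<lambda>\<alpha>. if \<alpha> \<in> S then c \<alpha> else 0)"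
  let ?I = "fst ` S" and ?J = "snd ` S"
  have fin: "finite ?I" "finite ?J"
    using assms(1) by auto
  have grid: "(\<Sum>i\<in>?I. (\<Sum>j\<in>?J. c' (i, j) * z2 powi j) * z1 powi i) = 0"
    if "z1 \<noteq> 0" "z2 \<noteq> 0" for z1 z2
  proof -
    have "(\<Sum>i\<in>?I. (\<Sum>j\<in>?J. c' (i, j) * z2 powi j) * z1 powi i) =
        (\<Sum>\<alpha>\<in>?I \<times> ?J. c' \<alpha> * z1 powi fst \<alpha> * z2 powi snd \<alpha>)"
      unfolding sum_distrib_right sum.cartesian_product
      by (intro sum.cong refl) (auto simp: mult_ac)
    also have "\<dots> = (\<Sum>\<alpha>\<in>S. c \<alpha> * z1 powi fst \<alpha> * z2 powi snd \<alpha>)"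
      using fin subset_fst_snd[of S]
      by (intro sum.mono_neutral_cong_right) (auto simp: c'_def)
    finally show ?thesis
      using zero[OF that] by simp
  qed
  have "(\<Sum>j\<in>?J. c' (fst \<beta>, j) * z2 powi j) = 0" if "z2 \<noteq> 0" for z2
    using power_int_sum_eq_0[OF fin(1), of "\<lambda>i. \<Sum>j\<in>?J. c' (i, j) * z2 powi j" "fst \<beta>"]
      grid that \<open>\<beta> \<in> S\<close> by blast
  then have "c' (fst \<beta>, snd \<beta>) = 0"
    using power_int_sum_eq_0[OF fin(2), of "\<lambda>j. c' (fst \<beta>, j)" "snd \<beta>"] \<open>\<beta> \<in> S\<close> by blast
  then show ?thesis
    using \<open>\<beta> \<in> S\<close> by (simp add: c'_def)
qed

text \<open>Reindexing by the involution \<open>r\<close> gives a second expansion of the same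
  function; coefficients are unique by \<open>power_int_sum2_eq_0\<close>.\<close>

lemma coef_invariant:
  assumes inv: "\<And>\<alpha>. r (r \<alpha>) = \<alpha>"
    and eq: "\<And>z1 z2. z1 \<noteq> 0 \<Longrightarrow> z2 \<noteq> 0 \<Longrightarrow> seval b z1 z2 =
      (\<Sum>\<alpha>\<in>Poly_Mapping.keys b. of_real (coef b \<alpha>) * z1 powi fst (r \<alpha>) * z2 powi snd (r \<alpha>))"
  shows "coef b (r \<alpha>) = coef b \<alpha>"
proof -
  let ?K = "Poly_Mapping.keys b"
  \<comment> \<open>Both expansions need a common index set, so the keys are closed up under
    \<open>r\<close>.\<close>
  define S where "S = ?K \<union> r ` ?K"
  have S: "finite S" "?K \<subseteq> S" "r ` S = S"
    by (auto simp: S_def image_Un image_image inv)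
  have "inj r"
    by (metis inv injI)
  have "of_real (coef b \<beta> - coef b (r \<beta>)) = (0 :: complex)" if "\<beta> \<in> S" for \<beta>
  proof (rule power_int_sum2_eq_0[OF S(1) _ that])
    fix z1 z2 :: complex
    assume z: "z1 \<noteq> 0" "z2 \<noteq> 0"
    have "seval b z1 z2 =
        (\<Sum>\<alpha>\<in>S. of_real (coef b \<alpha>) * z1 powi fst (r \<alpha>) * z2 powi snd (r \<alpha>))"
      unfolding eq[OF z] using S by (intro sum.mono_neutral_left) (auto simp: in_keys_iff)
    also have "\<dots> = (\<Sum>\<alpha>\<in>r ` S. of_real (coef b (r \<alpha>)) * z1 powi fst \<alpha> * z2 powi snd \<alpha>)"
      using \<open>inj r\<close> by (subst sum.reindex) (auto simp: inv inj_on_def)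
    finally have "seval b z1 z2 =
        (\<Sum>\<alpha>\<in>S. of_real (coef b (r \<alpha>)) * z1 powi fst \<alpha> * z2 powi snd \<alpha>)"
      using S(3) by simp
    then show "(\<Sum>\<alpha>\<in>S. of_real (coef b \<alpha> - coef b (r \<alpha>)) * z1 powi fst \<alpha> * z2 powi snd \<alpha>) = 0"
      using seval_superset[OF S(1,2), of z1 z2] by (simp add: algebra_simps sum_subtractf)
  qed
  moreover have "coef b \<alpha> = 0 \<and> coef b (r \<alpha>) = 0" if "\<alpha> \<notin> S"
    using that inv unfolding S_def by (metis UnCI image_eqI in_keys_iff)
  ultimately show ?thesis
    by (metis eq_iff_diff_eq_0 of_real_eq_0_iff)
qed

lemma symmetric_symbol_coef:
  assumes "symmetric_symbol b"
  shows "coef b (- i, j) = coef b (i, j)" "coef b (i, - j) = coef b (i, j)"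
    "coef b (j, i) = coef b (i, j)"
proof -
  note sym = assms[unfolded symmetric_symbol_def, rule_format]
  have "coef b ((\<lambda>(i, j). (- i, j)) (i, j)) = coef b (i, j)"
  proof (rule coef_invariant, clarsimp)
    fix z1 z2 :: complex
    assume z: "z1 \<noteq> 0" "z2 \<noteq> 0"
    then have "seval b z1 z2 = seval b (1 / z1) z2"
      using sym by blast
    then show "seval b z1 z2 = (\<Sum>\<alpha>\<in>Poly_Mapping.keys b. of_real (coef b \<alpha>) *
        z1 powi fst ((\<lambda>(i, j). (- i, j)) \<alpha>) * z2 powi snd ((\<lambda>(i, j). (- i, j)) \<alpha>))"
      by (simp add: seval_def case_prod_beta power_int_minus power_int_divide_distrib field_simps)
  qed
  then show "coef b (- i, j) = coef b (i, j)" by simp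
  have "coef b ((\<lambda>(i, j). (i, - j)) (i, j)) = coef b (i, j)"
  proof (rule coef_invariant, clarsimp)
    fix z1 z2 :: complex
    assume z: "z1 \<noteq> 0" "z2 \<noteq> 0"
    then have "seval b z1 z2 = seval b z1 (1 / z2)"
      using sym by blast
    then show "seval b z1 z2 = (\<Sum>\<alpha>\<in>Poly_Mapping.keys b. of_real (coef b \<alpha>) *
        z1 powi fst ((\<lambda>(i, j). (i, - j)) \<alpha>) * z2 powi snd ((\<lambda>(i, j). (i, - j)) \<alpha>))"
      by (simp add: seval_def case_prod_beta power_int_minus power_int_divide_distrib field_simps)
  qed
  then show "coef b (i, - j) = coef b (i, j)" by simp
  have "coef b (prod.swap (i, j)) = coef b (i, j)"
  proof (rule coef_invariant, clarsimp)
    fix z1 z2 :: complex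
    assume z: "z1 \<noteq> 0" "z2 \<noteq> 0"
    then have "seval b z1 z2 = seval b z2 z1"
      using sym by blast
    then show "seval b z1 z2 = (\<Sum>\<alpha>\<in>Poly_Mapping.keys b. of_real (coef b \<alpha>) *
        z1 powi fst (prod.swap \<alpha>) * z2 powi snd (prod.swap \<alpha>))"
      by (simp add: seval_def mult_ac)
  qed
  then show "coef b (j, i) = coef b (i, j)" by simp
qed

text \<open>Summing over the four sign changes multiplies the coefficient at (i, j) by (1 + (-1)^i)
  (1 + (-1)^j), which is 4 if both exponents are even and 0 otherwise. Comparison with the constant
  4 gives the values.\<close>

lemma interpolatory_coef:
  assumes "interpolatory b" "even i" "even j"
  shows "coef b (i, j) = (if (i, j) = (0, 0) then 1 else 0)"
proof (cases "(i, j) \<in> insert (0, 0) (Poly_Mapping.keys b)")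
  case True
  \<comment> \<open>The origin is adjoined so that the constant 4 is one of the summands even before
    (0, 0) is known to be a key.\<close>
  let ?S = "insert (0, 0) (Poly_Mapping.keys b)"
  define s where "s = (\<lambda>i :: int. if even i then 1 else - 1 :: complex)"
  have s: "(- z) powi i = s i * z powi i" for z i
    by (simp add: s_def power_int_minus_left)
  define c where "c = (\<lambda>\<alpha>. of_real (coef b \<alpha>) * (1 + s (fst \<alpha>)) * (1 + s (snd \<alpha>)) -
    (if \<alpha> = (0, 0) then 4 else 0))"
  have "c (i, j) = 0"
  proof (rule power_int_sum2_eq_0[of ?S])
    fix z1 z2 :: complex
    assume z: "z1 \<noteq> 0" "z2 \<noteq> 0"
    have sv: "seval b w1 w2 = (\<Sum>\<alpha>\<in>?S. of_real (coef b \<alpha>) * w1 powi fst \<alpha> * w2 powi snd \<alpha>)"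
      for w1 w2
      by (rule seval_superset) auto
    have "(\<Sum>\<alpha>\<in>?S. (if \<alpha> = (0, 0) then 4 else 0) * z1 powi fst \<alpha> * z2 powi snd \<alpha>) =
        (\<Sum>\<alpha>\<in>?S. if \<alpha> = (0, 0) then 4 else 0)"
      by (intro sum.cong) auto
    also have "\<dots> = 4"
      by (subst sum.delta) auto
    finally have four: "(\<Sum>\<alpha>\<in>?S. (if \<alpha> = (0, 0) then 4 else 0) * z1 powi fst \<alpha> * z2 powi snd \<alpha>) = 4" .
    have "(\<Sum>\<alpha>\<in>?S. c \<alpha> * z1 powi fst \<alpha> * z2 powi snd \<alpha>) =
        seval b z1 z2 + seval b z1 (- z2) + seval b (- z1) z2 + seval b (- z1) (- z2) -
        (\<Sum>\<alpha>\<in>?S. (if \<alpha> = (0, 0) then 4 else 0) * z1 powi fst \<alpha> * z2 powi snd \<alpha>)"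
      unfolding sv s sum.distrib[symmetric] sum_subtractf[symmetric]
      by (intro sum.cong refl) (simp add: c_def algebra_simps)
    then show "(\<Sum>\<alpha>\<in>?S. c \<alpha> * z1 powi fst \<alpha> * z2 powi snd \<alpha>) = 0"
      using assms(1) z unfolding four by (simp add: interpolatory_def)
  qed (use True in auto)
  then have "of_real (coef b (i, j)) * 4 = (if (i, j) = (0, 0) then 4 else 0 :: complex)"
    using assms(2,3) by (cases "(i, j) = (0, 0)") (auto simp: c_def s_def)
  then have "of_real (coef b (i, j)) = (of_real (if (i, j) = (0, 0) then 1 else 0) :: complex)"
    by (cases "(i, j) = (0, 0)") auto
  then show ?thesis
    unfolding of_real_eq_iff .
next
  case False
  then show ?thesis
    by (auto simp: in_keys_iff)
qed

text \<open>The four sign points filter out the even-even exponents, and for an interpolatory symbol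
  only the origin carries a nonzero one.\<close>

lemma moment_parity_sum:
  assumes "interpolatory b"
  shows "moment b g 1 1 + moment b g (- 1) 1 + moment b g 1 (- 1) + moment b g (- 1) (- 1) =
    of_real (4 * g (0, 0))"
proof -
  let ?K = "Poly_Mapping.keys b"
  have "moment b g 1 1 + moment b g (- 1) 1 + moment b g 1 (- 1) + moment b g (- 1) (- 1) =
      (\<Sum>\<alpha>\<in>?K. of_real (coef b \<alpha> * g \<alpha>) * (1 + (- 1) powi fst \<alpha>) * (1 + (- 1) powi snd \<alpha>))"
    unfolding moment_def sum.distrib[symmetric]
    by (intro sum.cong refl) (simp add: algebra_simps)
  also have "\<dots> = (\<Sum>\<alpha>\<in>?K. if \<alpha> = (0, 0) then of_real (4 * g (0, 0)) else 0)"
    using interpolatory_coef[OF assms]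
    by (intro sum.cong refl) (auto simp: power_int_minus_left split: if_splits)
  also have "\<dots> = of_real (4 * g (0, 0))"
    using interpolatory_coef[OF assms, of 0 0] by (auto simp: in_keys_iff)
  finally show ?thesis .
qed

text \<open>The moments on \<open>E'\<close> vanish, so the parity sum leaves the moment at (1, 1)
  equal to 4 times the weight at the origin, and \<open>ffact k 0\<close> is zero for positive
  k.\<close>

lemma interpolatory_generates_imp_reproduces:
  assumes "interpolatory b" "generates_polynomials b m"
  shows "reproduces_polynomials b m"
proof -
  have zero: "moment b (\<lambda>\<alpha>. ffact k1 (fst \<alpha>) * ffact k2 (snd \<alpha>)) 1 1 =
      of_real (4 * (ffact k1 0 * ffact k2 0))" if "k1 + k2 \<le> m" for k1 k2
    using moment_parity_sum[OF assms(1), of "\<lambda>\<alpha>. ffact k1 (fst \<alpha>) * ffact k2 (snd \<alpha>)"]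
      assms(2) that by (simp add: generates_polynomials_iff_moment E'_def)
  have "seval b 1 1 = Dk (0, 0) (seval b) 1 1"
    by (simp add: Dk_def)
  then have "seval b 1 1 = 4"
    using zero[of 0 0] by (simp add: Dk_seval)
  moreover have "Dk k (seval b) 1 1 = 0" if "0 < fst k + snd k" "fst k + snd k \<le> m" for k
    using zero[OF that(2)] that(1) by (auto simp: Dk_seval ffact_at_0)
  ultimately show ?thesis
    using assms(2) by (auto simp: reproduces_polynomials_def)
qed

section \<open>Lower bound for the support\<close>

text \<open>Passes from falling factorials to products with arbitrary roots: the factor x - c is
  split as (x - k) + (k - c), whose first part raises \<open>ffact k\<close> to
  \<open>ffact (Suc k)\<close>.\<close>

lemma moment_prod_eq_0:
  assumes gen: "\<And>k. k \<le> m \<Longrightarrow> moment b (\<lambda>\<alpha>. ffact k (fst \<alpha>)) z1 z2 = 0" and "k + r \<le> m"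
  shows "moment b (\<lambda>\<alpha>. ffact k (fst \<alpha>) * (\<Prod>i<r. of_int (fst \<alpha>) - c i)) z1 z2 = 0"
  using assms(2)
proof (induction r arbitrary: k)
  case (Suc r)
  let ?g = "\<lambda>k \<alpha>. ffact k (fst \<alpha>) * (\<Prod>i<r. of_int (fst \<alpha>) - c i)"
  have "moment b (\<lambda>\<alpha>. ffact k (fst \<alpha>) * (\<Prod>i<Suc r. of_int (fst \<alpha>) - c i)) z1 z2 =
      moment b (?g (Suc k)) z1 z2 + of_real (of_nat k - c r) * moment b (?g k) z1 z2"
    unfolding moment_def sum_distrib_left sum.distrib[symmetric]
    by (intro sum.cong refl) (simp add: ffact_Suc algebra_simps)
  also have "\<dots> = 0"
    using Suc.IH[of "Suc k"] Suc.IH[of k] Suc.prems by simp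
  finally show ?case .
qed (use gen in simp)

text \<open>
  The odd-odd part of the coefficients integrates every polynomial of degree at most \<open>2 n - 1\<close> in
  the first exponent to its value at \<open>0\<close>; a polynomial of degree \<open>2 n - 2\<close> vanishing at the odd
  integers below \<open>2 n - 1\<close> but not at \<open>0\<close> therefore forces a large exponent.
\<close>

lemma interpolatory_large_odd_exponent:
  assumes int: "interpolatory b" and gen: "generates_polynomials b (2 * n - 1)" and n: "n \<ge> 1"
  obtains i j where "coef b (i, j) \<noteq> 0" "\<bar>i\<bar> \<ge> 2 * int n - 1" "\<bar>j\<bar> \<ge> 1"
proof -
  \<comment> \<open>For i < 2 n - 2, \<open>c i\<close> runs through the odd integers from -(2 n -
    3) to 2 n - 3, so \<open>g\<close> vanishes at exactly these first exponents.\<close>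
  define c where "c = (\<lambda>i :: nat. 2 * int i + 3 - 2 * int n)"
  define g where "g = (\<lambda>\<alpha> :: int \<times> int. \<Prod>i<2 * n - 2. real_of_int (fst \<alpha>) - real_of_int (c i))"
  have odd_c: "odd (c i)" for i
    by (simp add: c_def)
  have "c i \<noteq> 0" for i
    using odd_c[of i] by fastforce
  then have g0: "g (0, 0) \<noteq> 0"
    by (simp add: g_def)
  have zero: "moment b g z1 z2 = 0" if "(z1, z2) \<in> E'" for z1 z2
  proof -
    have "moment b (\<lambda>\<alpha>. ffact 0 (fst \<alpha>) *
        (\<Prod>i<2 * n - 2. of_int (fst \<alpha>) - real_of_int (c i))) z1 z2 = 0"
    proof (rule moment_prod_eq_0[where m = "2 * n - 1"])
      fix k assume "k \<le> 2 * n - 1"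
      then show "moment b (\<lambda>\<alpha>. ffact k (fst \<alpha>)) z1 z2 = 0"
        using gen[unfolded generates_polynomials_iff_moment, rule_format, OF that,
          unfolded prod.case, rule_format, of k 0] by simp
    qed (use n in auto)
    then show ?thesis
      by (simp add: g_def)
  qed
  have "moment b g 1 1 = of_real (4 * g (0, 0))"
    using moment_parity_sum[OF int, of g] zero by (simp add: E'_def)
  \<comment> \<open>Since the three moments on \<open>E'\<close> are zero, the signs may be chosen
    freely; this choice keeps only terms with both exponents odd.\<close>
  then have "moment b g 1 1 - moment b g (- 1) 1 - moment b g 1 (- 1) + moment b g (- 1) (- 1) \<noteq> 0"
    using zero g0 by (simp add: E'_def)
  also have "moment b g 1 1 - moment b g (- 1) 1 - moment b g 1 (- 1) + moment b g (- 1) (- 1) =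
      (\<Sum>\<alpha>\<in>Poly_Mapping.keys b.
        of_real (coef b \<alpha> * g \<alpha>) * (1 - (- 1) powi fst \<alpha>) * (1 - (- 1) powi snd \<alpha>))"
    unfolding moment_def sum.distrib[symmetric] sum_subtractf[symmetric]
    by (intro sum.cong refl) (simp add: algebra_simps)
  finally obtain \<alpha> where \<alpha>: "of_real (coef b \<alpha> * g \<alpha>) * (1 - (- 1) powi fst \<alpha>) *
      (1 - (- 1) powi snd \<alpha>) \<noteq> (0 :: complex)"
    by (metis (no_types, lifting) sum.neutral)
  then have nz: "coef b \<alpha> \<noteq> 0" "g \<alpha> \<noteq> 0" and odd: "odd (fst \<alpha>)" "odd (snd \<alpha>)"
    by (auto simp: power_int_minus_left split: if_splits)
  have "\<bar>fst \<alpha>\<bar> \<ge> 2 * int n - 1"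
  proof (rule ccontr)
    assume "\<not> \<bar>fst \<alpha>\<bar> \<ge> 2 * int n - 1"
    moreover obtain t where t: "fst \<alpha> = 2 * t + 1"
      using odd(1) by (elim oddE)
    \<comment> \<open>The index comes from solving 2 i + 3 - 2 n = 2 t + 1 for i.\<close>
    ultimately have "fst \<alpha> = c (nat (t + int n - 1))" "nat (t + int n - 1) < 2 * n - 2"
      by (auto simp: c_def)
    then have "g \<alpha> = 0"
      by (force simp: g_def)
    then show False
      using nz by simp
  qed
  moreover have "\<bar>snd \<alpha>\<bar> \<ge> 1"
    using odd(2) by (cases "snd \<alpha> = 0") auto
  ultimately show ?thesis
    using that[of "fst \<alpha>" "snd \<alpha>"] nz by simp
qed

lemma convex_reflection_rectangle:
  fixes C :: "(real \<times> real) set"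
  assumes "convex C" and refl: "\<And>x y. (x, y) \<in> C \<Longrightarrow> (- x, y) \<in> C \<and> (x, - y) \<in> C"
    and "(x, y) \<in> C" "\<bar>x'\<bar> \<le> \<bar>x\<bar>" "\<bar>y'\<bar> \<le> \<bar>y\<bar>"
  shows "(x', y') \<in> C"
proof -
  have scale: "\<exists>s. \<bar>s\<bar> \<le> 1 \<and> u' = s * u" if "\<bar>u'\<bar> \<le> \<bar>u\<bar>" for u u' :: real
    using that by (cases "u = 0") (auto intro!: exI[of _ "u' / u"])
  obtain s t where s: "\<bar>s\<bar> \<le> 1" "x' = s * x" and t: "\<bar>t\<bar> \<le> 1" "y' = t * y"
    using scale assms(4,5) by metis
  \<comment> \<open>Scaling one coordinate by s with \<open>\<bar>s\<bar> \<le> 1\<close> is a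
    convex combination of the point and its mirror image; the two coordinates are treated in
    turn.\<close>
  have "((1 + s) / 2) *\<^sub>R (x, y) + ((1 - s) / 2) *\<^sub>R (- x, y) \<in> C"
    using assms(3) refl s by (intro convexD[OF assms(1)]) (auto simp: field_simps)
  then have "(x', y) \<in> C"
    using s by (simp add: field_simps)
  then have "((1 + t) / 2) *\<^sub>R (x', y) + ((1 - t) / 2) *\<^sub>R (x', - y) \<in> C"
    using refl t by (intro convexD[OF assms(1)]) (auto simp: field_simps)
  then show ?thesis
    using t by (simp add: field_simps)
qed

text \<open>Each of these maps is linear, hence commutes with the convex hull, and maps the set of
  exponents into itself.\<close>

lemma symmetric_symbol_support:
  assumes "symmetric_symbol b" "(x, y) \<in> symbol_support b"
  shows "(- x, y) \<in> symbol_support b" "(x, - y) \<in> symbol_support b" "(y, x) \<in> symbol_support b"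
proof -
  let ?T = "{(real_of_int i, real_of_int j) | i j. coef b (i, j) \<noteq> 0}"
  have inv: "f (x, y) \<in> symbol_support b" if "linear f" "f ` ?T \<subseteq> ?T"
    for f :: "real \<times> real \<Rightarrow> real \<times> real"
    using convex_hull_linear_image[OF that(1), of ?T] hull_mono[OF that(2), of convex] assms(2)
    unfolding symbol_support_def by blast
  note sym = symmetric_symbol_coef[OF assms(1)]
  have "(\<lambda>(x, y). (- x, y)) (x, y) \<in> symbol_support b"
  proof (rule inv)
    show "linear (\<lambda>(x :: real, y :: real). (- x, y))"
      by (rule linearI) auto
    show "(\<lambda>(x, y). (- x, y)) ` ?T \<subseteq> ?T"
      using sym(1) by (auto simp: image_iff) (metis of_int_minus)
  qed
  then show "(- x, y) \<in> symbol_support b" by simp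
  have "(\<lambda>(x, y). (x, - y)) (x, y) \<in> symbol_support b"
  proof (rule inv)
    show "linear (\<lambda>(x :: real, y :: real). (x, - y))"
      by (rule linearI) auto
    show "(\<lambda>(x, y). (x, - y)) ` ?T \<subseteq> ?T"
      using sym(2) by (auto simp: image_iff) (metis of_int_minus)
  qed
  then show "(x, - y) \<in> symbol_support b" by simp
  have "(\<lambda>(x, y). (y, x)) (x, y) \<in> symbol_support b"
  proof (rule inv)
    show "linear (\<lambda>(x :: real, y :: real). (y, x))"
      by (rule linearI) auto
    show "(\<lambda>(x, y). (y, x)) ` ?T \<subseteq> ?T"
      using sym(3) by force
  qed
  then show "(y, x) \<in> symbol_support b" by simp
qed

lemma convex_symbol_support: "convex (symbol_support b)"
  by (simp add: symbol_support_def)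

text \<open>Supplies measurability and finite area. Finiteness matters because
  \<open>measure\<close> turns an infinite value into 0 and would then not be monotone.\<close>

lemma compact_symbol_support: "compact (symbol_support b)"
proof -
  have "{(real_of_int i, real_of_int j) | i j. coef b (i, j) \<noteq> 0} =
      (\<lambda>\<alpha>. (real_of_int (fst \<alpha>), real_of_int (snd \<alpha>))) ` Poly_Mapping.keys b"
    by (force simp: in_keys_iff)
  then show ?thesis
    unfolding symbol_support_def by (simp add: finite_imp_compact_convex_hull)
qed

lemma support_size_mono:
  assumes "symbol_support a \<subseteq> symbol_support b"
  shows "support_size a \<le> support_size b"
  unfolding support_size_def
  using assms compact_symbol_support
  by (intro measure_mono_fmeasurable) (auto intro: fmeasurable_compact borel_compact)

text \<open>The corners (2 (n - i) - 1, 2 i + 1) lie on the segment from (2 n - 1, 1) to (1, 2 n -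
  1). A large odd exponent puts the first endpoint into the support, the coordinate swap adds the
  second, and reflections fill the rectangles.\<close>

lemma symbol_support_rectangles:
  assumes sym: "symmetric_symbol b" and "interpolatory b" "generates_polynomials b (2 * n - 1)"
    and "i < n" "\<bar>x\<bar> \<le> 2 * real (n - i) - 1" "\<bar>y\<bar> \<le> 2 * real i + 1"
  shows "(x, y) \<in> symbol_support b"
proof -
  note rect = convex_reflection_rectangle[OF convex_symbol_support]
  note refl = symmetric_symbol_support[OF sym]
  obtain p q where pq: "coef b (p, q) \<noteq> 0" "\<bar>p\<bar> \<ge> 2 * int n - 1" "\<bar>q\<bar> \<ge> 1"
    using interpolatory_large_odd_exponent assms by (metis less_one linorder_not_le not_less_zero)
  have "(real_of_int p, real_of_int q) \<in> symbol_support b"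
    unfolding symbol_support_def using pq by (auto intro!: hull_inc)
  then have A: "(2 * real n - 1, 1) \<in> symbol_support b"
    by (rule rect[rotated]) (use refl pq assms(4) in auto)
  then have B: "(1, 2 * real n - 1) \<in> symbol_support b"
    by (rule refl)
  have "(2 * real (n - i) - 1, 2 * real i + 1) \<in> symbol_support b"
  proof (cases "i = 0")
    case True
    with A show ?thesis by simp
  next
    case False
    \<comment> \<open>The position of the i-th corner on the segment. Here i is positive and less
      than n, so n - 1 is nonzero.\<close>
    define t where "t = real i / real (n - 1)"
    have n: "real (n - 1) > 0" "real (n - 1) = real n - 1"
      using False assms(4) by auto
    have t: "0 \<le> t" "t \<le> 1" "t * (real n - 1) = real i"
      using n assms(4) by (auto simp: t_def field_simps)
    have "(1 - t) *\<^sub>R (2 * real n - 1, 1) + t *\<^sub>R (1, 2 * real n - 1) \<in> symbol_support b"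
      using A B t by (intro convexD[OF convex_symbol_support]) auto
    moreover have "(1 - t) *\<^sub>R (2 * real n - 1, 1) + t *\<^sub>R (1, 2 * real n - 1) =
        (2 * real (n - i) - 1, 2 * real i + 1)"
      using t(3) assms(4) by (auto simp: of_nat_diff algebra_simps)
    ultimately show ?thesis by (simp only:)
  qed
  then show ?thesis
    by (rule rect[rotated]) (use refl assms in auto)
qed

section \<open>The pseudo-splines of maximal order\<close>

abbreviation ispline :: "nat \<Rightarrow> laurent"
  where "ispline r \<equiv> pseudo_spline r (r - 1)"

lemma sigma_plus_delta: "sigma + delta = 1"
proof -
  let ?w = "Poly_Mapping.single (- 1) (1 / 4) :: laurent"
  have "sigma + delta = Z * ?w + Z * ?w + Z * ?w + Z * ?w"
    by (simp add: sigma_def delta_def power2_eq_square algebra_simps)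
  also have "\<dots> = 1"
    by (simp add: Z_def mult_single flip: single_add)
  finally show ?thesis .
qed

text \<open>The truncated form of (1 - y) (1 - y)^(-n-1) = (1 - y)^(-n), with the last term as the
  truncation error; the induction step is Pascal's rule.\<close>

lemma sum_binomial_power_mult_one_minus:
  fixes y :: "'a :: comm_ring_1"
  shows "(1 - y) * (\<Sum>i=0..m. of_nat ((n + i) choose i) * y ^ i) =
    (\<Sum>i=0..m. of_nat ((n + i - 1) choose i) * y ^ i) - of_nat ((n + m) choose m) * y ^ Suc m"
proof (induction m)
  case (Suc m)
  have "of_nat ((n + Suc m) choose Suc m) =
      (of_nat ((n + m) choose m) + of_nat ((n + m) choose Suc m) :: 'a)"
    by simp
  then show ?case
    using Suc by (simp add: algebra_simps)
qed simp

lemma central_binomial_double: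
  assumes "r \<ge> 1"
  shows "(2 * r) choose r = 2 * ((2 * r - 1) choose r)"
proof -
  obtain m where m: "r = Suc m"
    using assms by (cases r) auto
  have "Suc (2 * m) choose m = Suc (2 * m) choose Suc m"
    using binomial_symmetric[of m "Suc (2 * m)"] by simp
  then show ?thesis
    by (simp add: m)
qed

text \<open>One factor \<open>sigma\<close> = 1 - \<open>delta\<close> of
  \<open>ispline (Suc r)\<close> is absorbed into its binomial sum, which becomes that of
  \<open>ispline r\<close> up to terms of degree r and r + 1 in \<open>delta\<close>.\<close>

lemma ispline_Suc_diff:
  assumes "r \<ge> 1"
  shows "ispline (Suc r) - ispline r =
    2 * sigma ^ r * delta ^ r * of_nat ((2 * r - 1) choose r) * (1 - 2 * delta)"
proof -
  let ?c = "of_nat ((2 * r - 1) choose r) :: laurent"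
  define S where "S = (\<Sum>i=0..r - 1. of_nat ((r + i - 1) choose i) * delta ^ i)"
  have S': "(\<Sum>i=0..r. of_nat ((r + i - 1) choose i) * delta ^ i) = S + ?c * delta ^ r"
    using assms sum.atLeast0_atMost_Suc[of "\<lambda>i. of_nat ((r + i - 1) choose i) * delta ^ i" "r - 1"]
    by (simp add: S_def mult_2)
  \<comment> \<open>The truncation error has exactly twice the coefficient of
    \<open>delta ^ r\<close>, which produces the factor 1 - 2 \<open>delta\<close>.\<close>
  have "of_nat ((r + r) choose r) = 2 * ?c"
    by (simp only: central_binomial_double[OF assms] of_nat_mult of_nat_numeral flip: mult_2)
  then have "(1 - delta) * (\<Sum>i=0..r. of_nat ((r + i) choose i) * delta ^ i) =
      S + ?c * delta ^ r - 2 * ?c * delta ^ Suc r"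
    by (simp only: sum_binomial_power_mult_one_minus S')
  moreover have "1 - delta = sigma"
    using sigma_plus_delta by (simp add: algebra_simps)
  ultimately have sig: "sigma * (\<Sum>i=0..r. of_nat ((r + i) choose i) * delta ^ i) =
      S + ?c * delta ^ r - 2 * ?c * delta ^ Suc r"
    by simp
  have "ispline (Suc r) = 2 * sigma ^ r * (sigma * (\<Sum>i=0..r. of_nat ((r + i) choose i) * delta ^ i))"
    by (simp add: pseudo_spline_def mult_ac)
  moreover have "ispline r = 2 * sigma ^ r * S"
    by (simp add: pseudo_spline_def S_def)
  ultimately show ?thesis
    unfolding sig by (simp add: algebra_simps)
qed

text \<open>Replacing z by -z swaps \<open>sigma\<close> and \<open>delta\<close>. The increments
  contain (\<open>sigma\<close> \<open>delta\<close>)^r (\<open>sigma\<close> -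
  \<open>delta\<close>) and so change sign; the sum of the values at z and -z thus keeps its value 2
  from r = 1.\<close>

lemma leval_ispline_minus:
  assumes "r \<ge> 1" "z \<noteq> 0"
  shows "leval (ispline r) (- z) = 2 - leval (ispline r) z"
  using assms(1)
proof (induction r rule: dec_induct)
  case base
  show ?case
    using assms(2) by (simp add: pseudo_spline_def leval_sigma field_simps power2_eq_square)
next
  case (step r)
  have sd: "leval sigma w = 1 - leval delta w" for w
    using arg_cong[OF sigma_plus_delta, of "\<lambda>p. leval p w"] by (simp add: algebra_simps)
  have "leval delta (- z) = leval sigma z"
    using assms(2) by (simp add: leval_sigma leval_delta)
  then have flip: "leval sigma (- z) = leval delta z" "leval delta (- z) = 1 - leval delta z"
    using sd[of z] sd[of "- z"] by simp_all
  have "leval (ispline (Suc r)) w = leval (ispline r) w +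
      2 * leval sigma w ^ r * leval delta w ^ r * of_nat ((2 * r - 1) choose r) *
      (1 - 2 * leval delta w)" if "w \<noteq> 0" for w
    using arg_cong[OF ispline_Suc_diff[OF step.hyps(1)], of "\<lambda>p. leval p w"] that
    by (simp add: algebra_simps)
  note rec = this[of z] this[of "- z"]
  have "leval (ispline (Suc r)) z + leval (ispline (Suc r)) (- z) =
      leval (ispline r) z + leval (ispline r) (- z)"
    using assms(2)
    by (simp only: rec flip sd neg_equal_0_iff_equal not_False_eq_True) (simp add: algebra_simps)
  then show ?case
    using step.IH by (simp add: algebra_simps)
qed

lemma leval_pseudo_spline_inverse:
  assumes "z \<noteq> 0"
  shows "leval (pseudo_spline r l) (1 / z) = leval (pseudo_spline r l) z"
proof -
  have "(1 + 1 / z)\<^sup>2 / (4 * (1 / z)) = (1 + z)\<^sup>2 / (4 * z)"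
    "(1 - 1 / z)\<^sup>2 / (4 * (1 / z)) = (1 - z)\<^sup>2 / (4 * z)"
    using assms by (simp_all add: field_simps power2_eq_square)
  then show ?thesis
    using assms by (subst (1 2) leval_pseudo_spline) (simp_all only: divide_eq_0_iff one_neq_zero simp_thms)
qed

text \<open>As c is its own inverse, 1 - c z has its root at c. Multiplying by this factor replaces
  the weight g(i) by g(i) - g(i + 1), which turns \<open>ffact k\<close> into -k
  \<open>ffact (k - 1)\<close> and kills constants; s factors thus annihilate all k < s.\<close>

lemma lmoment_root_factor:
  assumes "c = 1 \<or> c = - 1" "k < s"
  shows "lmoment ((1 - Poly_Mapping.single 1 c) ^ s * p) (ffact k) (of_real c) = 0"
  using assms(2)
proof (induction s arbitrary: k)
  case (Suc s)
  have c: "c * c = 1" "c \<noteq> 0"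
    using assms(1) by auto
  have step: "lmoment ((1 - Poly_Mapping.single 1 c) * q) g (of_real c) =
      lmoment q (\<lambda>i. g i - g (i + 1)) (of_real c)" for q g
  proof -
    have "Poly_Mapping.single 1 c * q =
        (\<Sum>i\<in>Poly_Mapping.keys q. Poly_Mapping.single (1 + i) (c * coef q i))"
      by (subst laurent_expand[of q]) (simp add: sum_distrib_left mult_single)
    then have "lmoment (Poly_Mapping.single 1 c * q) g (of_real c) =
        (\<Sum>i\<in>Poly_Mapping.keys q. of_real (c * coef q i * g (1 + i)) * of_real c powi (1 + i))"
      by (simp add: lmoment_sum)
    also have "\<dots> = (\<Sum>i\<in>Poly_Mapping.keys q.
        of_real (c * c) * (of_real (coef q i * g (i + 1)) * of_real c powi i))"
      using c(2) by (intro sum.cong refl) (simp add: power_int_add add.commute mult_ac)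
    finally show ?thesis
      unfolding left_diff_distrib lmoment_diff
      by (simp add: c lmoment_def algebra_simps sum_subtractf)
  qed
  let ?q = "(1 - Poly_Mapping.single 1 c) ^ s * p"
  have "lmoment ((1 - Poly_Mapping.single 1 c) ^ Suc s * p) (ffact k) (of_real c) =
      lmoment ?q (\<lambda>i. ffact k i - ffact k (i + 1)) (of_real c)"
    by (simp add: mult.assoc step)
  also have "\<dots> = 0"
  proof (cases k)
    case 0
    then show ?thesis by (simp add: lmoment_def)
  next
    case (Suc l)
    have "ffact k i - ffact k (i + 1) = - real k * ffact l i" for i
      unfolding Suc ffact_shift by (simp add: ffact_Suc algebra_simps)
    then have "lmoment ?q (\<lambda>i. ffact k i - ffact k (i + 1)) (of_real c) =
        - of_nat k * lmoment ?q (ffact l) (of_real c)"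
      by (simp add: lmoment_def sum_distrib_left mult_ac)
    also have "\<dots> = 0"
      using Suc.IH[of l] Suc.prems Suc by simp
    finally show ?thesis .
  qed
  finally show ?case .
qed simp

lemma lmoment_sigma_power:
  assumes "k < 2 * r"
  shows "lmoment (sigma ^ r * p) (ffact k) (- 1) = 0"
proof -
  have "1 + Z = 1 - Poly_Mapping.single 1 (- 1)"
    by (simp add: Z_def single_uminus)
  then have "sigma ^ r * p = (1 - Poly_Mapping.single 1 (- 1)) ^ (2 * r) *
      (Poly_Mapping.single (- 1) (1 / 4) ^ r * p)"
    by (simp only: sigma_def power_mult_distrib power_mult mult.assoc)
  then show ?thesis
    using lmoment_root_factor[of "- 1" k "2 * r"] assms by (simp only:) simp
qed

lemma lmoment_delta_power:
  assumes "k < 2 * r"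
  shows "lmoment (delta ^ r * p) (ffact k) 1 = 0"
proof -
  have delta: "delta = (1 - Poly_Mapping.single 1 1)\<^sup>2 * (- Poly_Mapping.single (- 1) (1 / 4))"
    by (simp add: delta_def Z_def)
  have "delta ^ r * p = (1 - Poly_Mapping.single 1 1) ^ (2 * r) *
      ((- Poly_Mapping.single (- 1) (1 / 4)) ^ r * p)"
    by (simp only: delta power_mult_distrib power_mult mult.assoc)
  then show ?thesis
    using lmoment_root_factor[of 1 k "2 * r"] assms by (simp only:) simp
qed

lemma lmoment_ispline:
  assumes "k < 2 * r"
  shows "lmoment (ispline r) (ffact k) (- 1) = 0"
  unfolding pseudo_spline_def mult.assoc mult.left_commute[of 2]
  by (rule lmoment_sigma_power[OF assms])

lemma lmoment_ispline_Suc_diff: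
  assumes "k < 2 * r" "z = 1 \<or> z = - 1"
  shows "lmoment (ispline (Suc r)) (ffact k) z - lmoment (ispline r) (ffact k) z = 0"
proof -
  have "r \<ge> 1"
    using assms(1) by simp
  note diff = ispline_Suc_diff[OF this]
  show ?thesis
    using assms(2)
  proof
    assume "z = 1"
    then show ?thesis
      using lmoment_delta_power[OF assms(1), of "2 * sigma ^ r * of_nat ((2 * r - 1) choose r) *
        (1 - 2 * delta)"]
      by (simp only: diff flip: lmoment_diff) (simp only: mult_ac)
  next
    assume "z = - 1"
    then show ?thesis
      using lmoment_sigma_power[OF assms(1), of "2 * delta ^ r * of_nat ((2 * r - 1) choose r) *
        (1 - 2 * delta)"]
      by (simp only: diff flip: lmoment_diff) (simp only: mult_ac)
  qed
qed

lemma keys_mult_subset_interval: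
  fixes p q :: laurent
  assumes "Poly_Mapping.keys p \<subseteq> {- d..d}" "Poly_Mapping.keys q \<subseteq> {- e..e}"
  shows "Poly_Mapping.keys (p * q) \<subseteq> {- (d + e)..d + e}"
  using keys_mult[of p q] assms by fastforce

lemma keys_power_subset_interval:
  fixes p :: laurent
  assumes "Poly_Mapping.keys p \<subseteq> {- 1..1}"
  shows "Poly_Mapping.keys (p ^ k) \<subseteq> {- int k..int k}"
proof (induction k)
  case (Suc k)
  then show ?case
    using keys_mult_subset_interval[OF assms Suc] by simp
qed simp

lemma keys_of_nat_laurent: "Poly_Mapping.keys (of_nat k :: laurent) \<subseteq> {0}"
  by (induction k) (use keys_add in \<open>fastforce+\<close>)

text \<open>Both \<open>sigma\<close> and \<open>delta\<close> have exponents in [-1, 1]; the power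
  of \<open>sigma\<close> contributes r and the sum in \<open>delta\<close> at most r - 1.\<close>

lemma keys_ispline:
  assumes "r \<ge> 1"
  shows "Poly_Mapping.keys (ispline r) \<subseteq> {- (2 * int r - 1)..2 * int r - 1}"
proof -
  have sigma_eq: "sigma = Poly_Mapping.single (- 1) (1 / 4) + Poly_Mapping.single 0 (1 / 4) +
      Poly_Mapping.single 0 (1 / 4) + Poly_Mapping.single 1 (1 / 4)"
    by (simp add: sigma_def Z_def power2_eq_square algebra_simps mult_single)
  have sigma: "Poly_Mapping.keys sigma \<subseteq> {- 1..1}"
    unfolding sigma_eq
    by (intro order.trans[OF keys_add] Un_least) (auto split: if_splits)
  have "delta = 1 - sigma"
    using sigma_plus_delta by (simp add: algebra_simps)
  then have delta: "Poly_Mapping.keys delta \<subseteq> {- 1..1}"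
    using keys_diff[of 1 sigma] sigma by fastforce
  have summand: "Poly_Mapping.keys (of_nat k * delta ^ i) \<subseteq> {- (int r - 1)..int r - 1}"
    if "i \<le> r - 1" for i k
  proof -
    have "Poly_Mapping.keys (of_nat k :: laurent) \<subseteq> {- 0..0}"
      using keys_of_nat_laurent[of k] by simp
    from keys_mult_subset_interval[OF this keys_power_subset_interval[OF delta, of i]]
    show ?thesis
      using that assms by fastforce
  qed
  have S: "Poly_Mapping.keys (\<Sum>i=0..r - 1. of_nat ((r + i - 1) choose i) * delta ^ i)
      \<subseteq> {- (int r - 1)..int r - 1}"
    by (rule order.trans[OF keys_sum]) (use summand in fastforce)
  have "Poly_Mapping.keys (2 :: laurent) \<subseteq> {- 0..0}"
    using keys_of_nat_laurent[of 2] by simp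
  from keys_mult_subset_interval[OF
      keys_mult_subset_interval[OF this keys_power_subset_interval[OF sigma, of r]] S]
  show ?thesis
    by (simp add: pseudo_spline_def algebra_simps)
qed

section \<open>Properties of \<open>a_hat\<close>\<close>

text \<open>The convolution over index pairs r, s \<ge> 1 with r + s = n + 1; \<open>a_hat n\<close>
  is the difference of two consecutive ones, for function values as well as for moments.\<close>

definition conv :: "(nat \<Rightarrow> 'a :: comm_ring) \<Rightarrow> (nat \<Rightarrow> 'a) \<Rightarrow> nat \<Rightarrow> 'a"
  where "conv A B n = (\<Sum>i<n. A (n - i) * B (i + 1))"

lemma conv_commute: "conv A B n = conv B A n"
  unfolding conv_def
  by (subst sum.nat_diff_reindex[symmetric])
     (intro sum.cong refl, simp add: mult.commute Suc_diff_Suc)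

text \<open>Splitting off the term i = 0 aligns the longer sum with the shorter one, so that the
  difference falls on \<open>B\<close> alone.\<close>

lemma conv_Suc_diff:
  "conv A B (Suc m) - conv A B m =
    A (Suc m) * B 1 + (\<Sum>i<m. A (m - i) * (B (Suc (i + 1)) - B (i + 1)))"
  unfolding conv_def sum.lessThan_Suc_shift
  by (simp add: algebra_simps sum_subtractf)

lemma seval_a_hat_conv:
  "seval (a_hat n) z1 z2 =
    conv (\<lambda>r. leval (ispline r) z1) (\<lambda>r. leval (ispline r) z2) n -
    conv (\<lambda>r. leval (ispline r) z1) (\<lambda>r. leval (ispline r) z2) (n - 1)"
  by (simp add: seval_a_hat conv_def numeral_2_eq_2 diff_commute)

lemma moment_a_hat_conv:
  "moment (a_hat n) (\<lambda>\<alpha>. g (fst \<alpha>) * h (snd \<alpha>)) z1 z2 =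
    conv (\<lambda>r. lmoment (ispline r) g z1) (\<lambda>r. lmoment (ispline r) h z2) n -
    conv (\<lambda>r. lmoment (ispline r) g z1) (\<lambda>r. lmoment (ispline r) h z2) (n - 1)"
  by (simp add: a_hat_def moment_diff moment_sum moment_tensor conv_def numeral_2_eq_2 diff_commute)

lemma symmetric_a_hat: "symmetric_symbol (a_hat n)"
  unfolding symmetric_symbol_def
proof (intro allI impI conjI)
  fix z1 z2 :: complex
  assume "z1 \<noteq> 0" "z2 \<noteq> 0"
  then show "seval (a_hat n) z1 z2 = seval (a_hat n) (1 / z1) z2"
    "seval (a_hat n) z1 z2 = seval (a_hat n) z1 (1 / z2)"
    unfolding seval_a_hat_conv by (simp_all only: leval_pseudo_spline_inverse not_False_eq_True)
  show "seval (a_hat n) z1 z2 = seval (a_hat n) z2 z1"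
    unfolding seval_a_hat_conv by (simp only: conv_commute[of "\<lambda>r. leval (ispline r) z1"])
qed

text \<open>For each tensor product the four sign values add up to 2 times 2; there are n products
  with plus sign and n - 1 with minus sign.\<close>

lemma interpolatory_a_hat:
  assumes "n \<ge> 1"
  shows "interpolatory (a_hat n)"
  unfolding interpolatory_def
proof (intro allI impI)
  fix z1 z2 :: complex
  assume z: "z1 \<noteq> 0" "z2 \<noteq> 0"
  let ?C = "\<lambda>w1 w2. conv (\<lambda>r. leval (ispline r) w1) (\<lambda>r. leval (ispline r) w2)"
  have "?C z1 z2 m + ?C z1 (- z2) m + ?C (- z1) z2 m + ?C (- z1) (- z2) m = 4 * of_nat m" for m
  proof -
    have "?C z1 z2 m + ?C z1 (- z2) m + ?C (- z1) z2 m + ?C (- z1) (- z2) m = (\<Sum>i<m. 4)"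
      unfolding conv_def sum.distrib[symmetric]
    proof (intro sum.cong refl)
      fix i assume "i \<in> {..<m}"
      then have "m - i \<ge> 1" "i + 1 \<ge> 1"
        by auto
      note flip = leval_ispline_minus[OF this(1) z(1)] leval_ispline_minus[OF this(2) z(2)]
      show "leval (ispline (m - i)) z1 * leval (ispline (i + 1)) z2 +
          leval (ispline (m - i)) z1 * leval (ispline (i + 1)) (- z2) +
          leval (ispline (m - i)) (- z1) * leval (ispline (i + 1)) z2 +
          leval (ispline (m - i)) (- z1) * leval (ispline (i + 1)) (- z2) = 4"
        unfolding flip by (simp add: algebra_simps)
    qed
    then show ?thesis by simp
  qed
  from this[of n] this[of "n - 1"]
  show "seval (a_hat n) z1 z2 + seval (a_hat n) z1 (- z2) + seval (a_hat n) (- z1) z2 +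
      seval (a_hat n) (- z1) (- z2) = 4"
    using assms unfolding seval_a_hat_conv by (simp add: of_nat_diff algebra_simps)
qed

text \<open>After regrouping, the i-th summand vanishes to order 2 (m - i) in the first variable and
  2 (i + 1) in the second, where n = m + 1. These orders add up to 2 n > k + l, so one factor is
  zero; the leading term vanishes because k < 2 n.\<close>

lemma conv_lmoment_diff_eq_0:
  assumes "k + l < 2 * n" "w = 1 \<or> w = - 1"
  shows "conv (\<lambda>r. lmoment (ispline r) (ffact k) (- 1)) (\<lambda>r. lmoment (ispline r) (ffact l) w) n -
    conv (\<lambda>r. lmoment (ispline r) (ffact k) (- 1)) (\<lambda>r. lmoment (ispline r) (ffact l) w) (n - 1) = 0"
proof -
  obtain m where m: "n = Suc m"
    using assms(1) by (cases n) auto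
  have "k < 2 * Suc m"
    using assms(1) m by simp
  note top = lmoment_ispline[OF this]
  have "lmoment (ispline (m - i)) (ffact k) (- 1) * (lmoment (ispline (Suc (i + 1))) (ffact l) w -
      lmoment (ispline (i + 1)) (ffact l) w) = 0" if "i < m" for i
  proof (cases "k < 2 * (m - i)")
    case True
    then show ?thesis by (simp only: lmoment_ispline mult_zero_left)
  next
    case False
    then have "l < 2 * (i + 1)"
      using assms(1) m that by simp
    then show ?thesis
      using lmoment_ispline_Suc_diff[OF _ assms(2), of l "i + 1"] by simp
  qed
  then show ?thesis
    unfolding m diff_Suc_1 conv_Suc_diff using top by (simp add: sum.neutral)
qed

lemma generates_polynomials_a_hat:
  assumes "n \<ge> 1"
  shows "generates_polynomials (a_hat n) (2 * n - 1)"
  unfolding generates_polynomials_iff_moment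
proof (clarify)
  fix z1 z2 k1 k2
  assume E: "(z1, z2) \<in> E'" and "k1 + k2 \<le> 2 * n - 1"
  then have k: "k1 + k2 < 2 * n" "k2 + k1 < 2 * n"
    using assms by auto
  \<comment> \<open>Every point of \<open>E'\<close> has a coordinate -1 and the other one is 1 or
    -1; the second case exchanges the factors by commutativity of \<open>conv\<close>.\<close>
  consider "z1 = - 1" "z2 = 1 \<or> z2 = - 1" | "z2 = - 1" "z1 = 1 \<or> z1 = - 1"
    using E by (auto simp: E'_def)
  then show "moment (a_hat n) (\<lambda>\<alpha>. ffact k1 (fst \<alpha>) * ffact k2 (snd \<alpha>)) z1 z2 = 0"
  proof cases
    case 1
    then show ?thesis
      unfolding moment_a_hat_conv using conv_lmoment_diff_eq_0[OF k(1)] by simp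
  next
    case 2
    then show ?thesis
      unfolding moment_a_hat_conv conv_commute[of "\<lambda>r. lmoment (ispline r) (ffact k1) z1"]
      using conv_lmoment_diff_eq_0[OF k(2)] by simp
  qed
qed

lemma keys_tensor:
  "Poly_Mapping.keys (tensor p q) \<subseteq> Poly_Mapping.keys p \<times> Poly_Mapping.keys q"
  unfolding tensor_def
  by (intro order.trans[OF keys_sum] UN_least) (auto split: if_splits)

lemma keys_a_hat:
  assumes "(x, y) \<in> Poly_Mapping.keys (a_hat n)"
  obtains i where "i < n" "\<bar>x\<bar> \<le> 2 * int (n - i) - 1" "\<bar>y\<bar> \<le> 2 * int i + 1"
proof -
  have tensor: "\<bar>x\<bar> \<le> 2 * int r - 1 \<and> \<bar>y\<bar> \<le> 2 * int s - 1"
    if "(x, y) \<in> Poly_Mapping.keys (tensor (ispline r) (ispline s))" "r \<ge> 1" "s \<ge> 1" for r s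
    using subsetD[OF keys_tensor that(1)] keys_ispline[OF that(2)] keys_ispline[OF that(3)]
    by fastforce
  have "(x, y) \<in> Poly_Mapping.keys (\<Sum>i<n. tensor (ispline (n - i)) (ispline (i + 1))) \<union>
      Poly_Mapping.keys (\<Sum>i<n - 1. tensor (ispline (n - i - 1)) (ispline (i + 1)))"
    using assms keys_diff by (fastforce simp: a_hat_def numeral_2_eq_2)
  then have "(\<exists>i<n. (x, y) \<in> Poly_Mapping.keys (tensor (ispline (n - i)) (ispline (i + 1)))) \<or>
      (\<exists>i<n - 1. (x, y) \<in> Poly_Mapping.keys (tensor (ispline (n - i - 1)) (ispline (i + 1))))"
    using keys_sum[of "\<lambda>i. tensor (ispline (n - i)) (ispline (i + 1))" "{..<n}"]
      keys_sum[of "\<lambda>i. tensor (ispline (n - i - 1)) (ispline (i + 1))" "{..<n - 1}"]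
    by blast
  then show ?thesis
  proof (elim disjE exE conjE)
    fix i assume "i < n" "(x, y) \<in> Poly_Mapping.keys (tensor (ispline (n - i)) (ispline (i + 1)))"
    then have "\<bar>x\<bar> \<le> 2 * int (n - i) - 1 \<and> \<bar>y\<bar> \<le> 2 * int (i + 1) - 1"
      by (intro tensor) auto
    with \<open>i < n\<close> show ?thesis
      by (intro that[of i]) auto
  next
    \<comment> \<open>The rectangles of the subtracted sum are contained in those of the first sum
      with the same i.\<close>
    fix i assume "i < n - 1"
      "(x, y) \<in> Poly_Mapping.keys (tensor (ispline (n - i - 1)) (ispline (i + 1)))"
    then have "\<bar>x\<bar> \<le> 2 * int (n - i - 1) - 1 \<and> \<bar>y\<bar> \<le> 2 * int (i + 1) - 1"
      by (intro tensor) auto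
    with \<open>i < n - 1\<close> show ?thesis
      by (intro that[of i]) auto
  qed
qed

text \<open>Every exponent of \<open>a_hat n\<close> lies in one of the rectangles that the support
  of \<open>b\<close> must contain, and that support is convex.\<close>

lemma symbol_support_a_hat_minimal:
  assumes "symmetric_symbol b" "interpolatory b" "generates_polynomials b (2 * n - 1)"
  shows "symbol_support (a_hat n) \<subseteq> symbol_support b"
proof -
  have "(real_of_int x, real_of_int y) \<in> symbol_support b"
    if nz: "coef (a_hat n) (x, y) \<noteq> 0" for x y
  proof -
    obtain i where i: "i < n" "\<bar>x\<bar> \<le> 2 * int (n - i) - 1" "\<bar>y\<bar> \<le> 2 * int i + 1"
      using keys_a_hat[of x y n] nz by (metis in_keys_iff)
    show ?thesis
      by (rule symbol_support_rectangles[OF assms i(1)]) (use i(2,3) in linarith)+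
  qed
  then show ?thesis
    unfolding symbol_support_def[of "a_hat n"]
    by (intro hull_minimal convex_symbol_support) auto
qed

theorem proposition3p3:
  fixes n :: nat
  assumes "n \<ge> 1"
  shows "interpolatory (a_hat n) \<and>
    generates_polynomials (a_hat n) (2 * n - 1) \<and>
    reproduces_polynomials (a_hat n) (2 * n - 1) \<and>
    is_arg_min support_size
      (\<lambda>b. symmetric_symbol b \<and> interpolatory b \<and> generates_polynomials b (2 * n - 1))
      (a_hat n)"
  using interpolatory_a_hat[OF assms] generates_polynomials_a_hat[OF assms]
    interpolatory_generates_imp_reproduces symmetric_a_hat
    support_size_mono[OF symbol_support_a_hat_minimal]
  by (auto simp: is_arg_min_def not_less)

end
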